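(* Let $S$ be a principal ideal semidomain. Then $S$ is a Goldman-Krull semidomain if and only if $S$ has only finitely many prime ideals.
   Context: A semiring is a set $S$ with two operations $+$ and $\cdot$ such that $(S,+)$ is a commutative monoid with identity $0$, $(S,\cdot)$ is a commutative monoid with identity $1\neq 0$, multiplication distributes over addition, and $s\cdot 0=0$ for all $s\in S$. A semidomain is a semiring $S$ such that $ab=ac$ implies $b=c$ for all $b,c\in S$ and all nonzero $a\in S$. An ideal of $S$ is a nonempty subset $I$ with $a+b\in I$ and $sa\in I$ for all $a,b\in I$, $s\in S$; a proper ideal $P$ (i.e. $P\neq S$) is prime if $ab\in P$ implies $a\in P$ or $b\in P$. An ideal is principal if it equals $(a)=\{sa: s\in S\}$ for some $a\in S$. A principal ideal semidomain (PISD) is a semidomain all of whose ideals are principal. The semifield of fractions $F(S)$ of a semidomain $S$ consists of the fractions $a/b$ with $a,b\in S$, $b\ne 0$, where $a/b=c/d$ iff $ad=bc$, with the usual operations; $S$ is regarded as a subsemiring of $F(S)$. If $S$ is a subsemiring of a semiring $T$ (a subset closed under $+$ and $\cdot$ and containing $0_T,1_T$), then $T$ is a finitely generated semiring over $S$ if there are finitely many elements $t_1,\ldots,t_n\in T$ such that every $x\in T$ has the form $x=s_1x_1+\cdots+s_mx_m$ with $s_i\in S$ and $x_i$ in the multiplicative submonoid of $T$ generated by $t_1,\ldots,t_n$. A semidomain $S$ is a Goldman-Krull semidomain if $F(S)$ is a finitely generated semiring over $S$. *)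

theory Defs
  imports Main
begin

text \<open>
  A semiring in the present sense (commutative, with \<open>1 \<noteq> 0\<close>, additive cancellation not
  required) is exactly an instance of the class \<^class>\<open>comm_semiring_1\<close>. The library class
  \<^class>\<open>semidom\<close> is too strong for semidomains, since it demands additive cancellation.
\<close>

class semidomain = comm_semiring_1 +
  assumes semidomain_cancel: "a \<noteq> 0 \<Longrightarrow> a * b = a * c \<Longrightarrow> b = c"
begin

subclass semiring_no_zero_divisors_cancel
proof
  fix a b c :: 'a
  show "a \<noteq> 0 \<Longrightarrow> b \<noteq> 0 \<Longrightarrow> a * b \<noteq> 0"
    using semidomain_cancel[of a b 0] by auto
  show "a * c = b * c \<longleftrightarrow> c = 0 \<or> a = b"
    using semidomain_cancel[of c a b] by (auto simp: mult.commute)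
  show "c * a = c * b \<longleftrightarrow> c = 0 \<or> a = b"
    using semidomain_cancel[of c a b] by auto
qed

end


section \<open>Ideals\<close>

definition semiring_ideal :: "'a::comm_semiring_1 set \<Rightarrow> bool" where
  "semiring_ideal I \<longleftrightarrow>
     I \<noteq> {} \<and> (\<forall>a\<in>I. \<forall>b\<in>I. a + b \<in> I) \<and> (\<forall>s. \<forall>a\<in>I. s * a \<in> I)"

definition prime_semiring_ideal :: "'a::comm_semiring_1 set \<Rightarrow> bool" where
  "prime_semiring_ideal P \<longleftrightarrow>
     semiring_ideal P \<and> P \<noteq> UNIV \<and> (\<forall>a b. a * b \<in> P \<longrightarrow> a \<in> P \<or> b \<in> P)"

definition principal_semiring_ideal :: "'a::comm_semiring_1 set \<Rightarrow> bool" where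
  "principal_semiring_ideal I \<longleftrightarrow> (\<exists>a. I = {s * a | s. True})"

definition principal_ideal_semidomain :: "'a::semidomain itself \<Rightarrow> bool" where
  "principal_ideal_semidomain _ \<longleftrightarrow>
     (\<forall>I :: 'a set. semiring_ideal I \<longrightarrow> principal_semiring_ideal I)"


section \<open>The semifield of fractions\<close>

definition fraction_rel :: "'a::semidomain \<times> 'a \<Rightarrow> 'a \<times> 'a \<Rightarrow> bool" where
  "fraction_rel x y \<longleftrightarrow> snd x \<noteq> 0 \<and> snd y \<noteq> 0 \<and> fst x * snd y = fst y * snd x"

lemma fraction_rel_iff [simp]:
  "fraction_rel (a, b) (c, d) \<longleftrightarrow> b \<noteq> 0 \<and> d \<noteq> 0 \<and> a * d = c * b"
  by (simp add: fraction_rel_def)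

lemma part_equivp_fraction_rel: "part_equivp (fraction_rel :: 'a::semidomain \<times> 'a \<Rightarrow> _)"
proof (rule part_equivpI)
  have "fraction_rel (0, 1) (0 :: 'a, 1 :: 'a)"
    by simp
  then show "\<exists>x::'a \<times> 'a. fraction_rel x x" ..
  show "symp (fraction_rel :: 'a \<times> 'a \<Rightarrow> _)"
    by (auto simp: fraction_rel_def intro!: sympI)
  show "transp (fraction_rel :: 'a \<times> 'a \<Rightarrow> _)"
  proof (rule transpI)
    fix x y z :: "'a \<times> 'a"
    assume xy: "fraction_rel x y" and yz: "fraction_rel y z"
    have nz: "snd x \<noteq> 0" "snd y \<noteq> 0" "snd z \<noteq> 0"
      using xy yz by (auto simp: fraction_rel_def)
    have "snd y * (fst x * snd z) = (fst x * snd y) * snd z"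
      by (simp add: ac_simps)
    also have "\<dots> = (fst y * snd z) * snd x"
      using xy by (simp add: fraction_rel_def ac_simps)
    also have "\<dots> = snd y * (fst z * snd x)"
      using yz by (simp add: fraction_rel_def ac_simps)
    finally show "fraction_rel x z"
      using nz by (simp add: fraction_rel_def)
  qed
qed

quotient_type (overloaded) 'a semifraction = "'a::semidomain \<times> 'a" / partial: fraction_rel
  by (rule part_equivp_fraction_rel)

text \<open>\<open>Frac a b\<close> is the fraction \<open>a/b\<close>; for \<open>b = 0\<close> it is the junk value \<open>0/1\<close>.\<close>

lift_definition Frac :: "'a::semidomain \<Rightarrow> 'a \<Rightarrow> 'a semifraction"
  is "\<lambda>a b. if b = 0 then (0, 1) else (a, b)"
  by simp

instantiation semifraction :: (semidomain) comm_semiring_1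
begin

lift_definition zero_semifraction :: "'a semifraction" is "(0, 1)"
  by simp

lift_definition one_semifraction :: "'a semifraction" is "(1, 1)"
  by simp

lift_definition plus_semifraction :: "'a semifraction \<Rightarrow> 'a semifraction \<Rightarrow> 'a semifraction"
  is "\<lambda>x y. (fst x * snd y + fst y * snd x, snd x * snd y)"
proof -
  fix x x' y y' :: "'a \<times> 'a"
  assume x: "fraction_rel x x'" and y: "fraction_rel y y'"
  have "(fst x * snd y + fst y * snd x) * (snd x' * snd y')
      = (fst x * snd x') * (snd y * snd y') + (fst y * snd y') * (snd x * snd x')"
    by (simp add: algebra_simps)
  also have "\<dots> = (fst x' * snd x) * (snd y * snd y') + (fst y' * snd y) * (snd x * snd x')"
    using x y by (simp add: fraction_rel_def)
  also have "\<dots> = (fst x' * snd y' + fst y' * snd x') * (snd x * snd y)"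
    by (simp add: algebra_simps)
  finally show "fraction_rel (fst x * snd y + fst y * snd x, snd x * snd y)
      (fst x' * snd y' + fst y' * snd x', snd x' * snd y')"
    using x y by (simp add: fraction_rel_def)
qed

lift_definition times_semifraction :: "'a semifraction \<Rightarrow> 'a semifraction \<Rightarrow> 'a semifraction"
  is "\<lambda>x y. (fst x * fst y, snd x * snd y)"
proof -
  fix x x' y y' :: "'a \<times> 'a"
  assume x: "fraction_rel x x'" and y: "fraction_rel y y'"
  have "(fst x * fst y) * (snd x' * snd y') = (fst x * snd x') * (fst y * snd y')"
    by (simp add: ac_simps)
  also have "\<dots> = (fst x' * snd x) * (fst y' * snd y)"
    using x y by (simp add: fraction_rel_def)
  also have "\<dots> = (fst x' * fst y') * (snd x * snd y)"
    by (simp add: ac_simps)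
  finally show "fraction_rel (fst x * fst y, snd x * snd y) (fst x' * fst y', snd x' * snd y')"
    using x y by (simp add: fraction_rel_def)
qed

instance
proof
  fix a b c :: "'a semifraction"
  show "a + b + c = a + (b + c)"
    by transfer (auto simp: fraction_rel_def algebra_simps)
  show "a + b = b + a"
    by transfer (auto simp: fraction_rel_def algebra_simps)
  show "0 + a = a"
    by transfer (auto simp: fraction_rel_def)
  show "a * b * c = a * (b * c)"
    by transfer (auto simp: fraction_rel_def ac_simps)
  show "a * b = b * a"
    by transfer (auto simp: fraction_rel_def ac_simps)
  show "1 * a = a"
    by transfer (auto simp: fraction_rel_def)
  show "(a + b) * c = a * c + b * c"
    by transfer (auto simp: fraction_rel_def algebra_simps)
  show "0 * a = 0"
    by transfer (auto simp: fraction_rel_def)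
  show "a * 0 = 0"
    by transfer (auto simp: fraction_rel_def)
  show "(0 :: 'a semifraction) \<noteq> 1"
    by transfer simp
qed

end

lemma Frac_eq_iff:
  "b \<noteq> 0 \<Longrightarrow> d \<noteq> 0 \<Longrightarrow> Frac a b = Frac c d \<longleftrightarrow> a * d = b * c"
  by transfer (simp add: mult.commute)

lemma Frac_add:
  "b \<noteq> 0 \<Longrightarrow> d \<noteq> 0 \<Longrightarrow> Frac a b + Frac c d = Frac (a * d + b * c) (b * d)"
  by transfer (simp add: algebra_simps)

lemma Frac_mult: "b \<noteq> 0 \<Longrightarrow> d \<noteq> 0 \<Longrightarrow> Frac a b * Frac c d = Frac (a * c) (b * d)"
  by transfer simp

lemma zero_eq_Frac: "0 = Frac 0 1"
  by transfer simp

lemma one_eq_Frac: "1 = Frac 1 1"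
  by transfer simp

lemma semifraction_cases: obtains a b where "b \<noteq> 0" "x = Frac a b"
proof -
  have "\<exists>a b. b \<noteq> 0 \<and> x = Frac a b"
    by transfer (auto simp: fraction_rel_def)
  then show ?thesis using that by blast
qed

definition semifraction_embed :: "'a::semidomain \<Rightarrow> 'a semifraction" where
  "semifraction_embed a = Frac a 1"

lemma inj_semifraction_embed: "inj semifraction_embed"
  by (rule injI) (simp add: semifraction_embed_def Frac_eq_iff)


section \<open>Finitely generated semirings and Goldman-Krull semidomains\<close>

definition subsemiring :: "'b::comm_semiring_1 set \<Rightarrow> bool" where
  "subsemiring S \<longleftrightarrow> 0 \<in> S \<and> 1 \<in> S \<and> (\<forall>a\<in>S. \<forall>b\<in>S. a + b \<in> S \<and> a * b \<in> S)"

inductive_set generated_submonoid :: "'b::comm_monoid_mult set \<Rightarrow> 'b set" for G where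
  one: "1 \<in> generated_submonoid G"
| incl: "t \<in> G \<Longrightarrow> t \<in> generated_submonoid G"
| mult: "x \<in> generated_submonoid G \<Longrightarrow> y \<in> generated_submonoid G \<Longrightarrow>
    x * y \<in> generated_submonoid G"

text \<open>The overring \<open>T\<close> is the whole type \<open>'b\<close>; the base \<open>S\<close> is a subsemiring of it.\<close>

definition finitely_generated_semiring_over :: "'b::comm_semiring_1 set \<Rightarrow> bool" where
  "finitely_generated_semiring_over S \<longleftrightarrow> subsemiring S \<and>
     (\<exists>G. finite G \<and>
       (\<forall>x. \<exists>(m::nat) s y. (\<forall>i<m. s i \<in> S \<and> y i \<in> generated_submonoid G) \<and>
              x = (\<Sum>i<m. s i * y i)))"

lemma subsemiring_range_embed: "subsemiring (range semifraction_embed)"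
  unfolding subsemiring_def semifraction_embed_def
  by (auto simp: Frac_add Frac_mult zero_eq_Frac one_eq_Frac)

definition Goldman_Krull :: "'a::semidomain itself \<Rightarrow> bool" where
  "Goldman_Krull _ \<longleftrightarrow>
     finitely_generated_semiring_over (range (semifraction_embed :: 'a \<Rightarrow> 'a semifraction))"

end

theory Submission
  imports Defs
begin

text \<open>
  Both conditions are compared with a third one: some nonzero \<open>d\<close> has the property that every
  nonzero element divides a power of \<open>d\<close>. For a Goldman-Krull semidomain, take \<open>d\<close> to be the product
  of the denominators of the generators; conversely \<open>1/d\<close> generates \<open>F(S)\<close>. If \<open>d\<close> is as above,
  every nonzero prime ideal contains \<open>d\<close>, and in a principal ideal semidomain only finitely many
  primes divide \<open>d\<close>. If there are only finitely many prime ideals, take for \<open>d\<close> the product of one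
  nonzero element from each of the nonzero ones: by Krull's maximality argument, a nonzero element
  dividing no power of \<open>d\<close> would lie in a prime ideal that avoids \<open>d\<close>.
\<close>

section \<open>Ideals\<close>

lemma semiring_ideal_add: "semiring_ideal I \<Longrightarrow> a \<in> I \<Longrightarrow> b \<in> I \<Longrightarrow> a + b \<in> I"
  and semiring_ideal_mult: "semiring_ideal I \<Longrightarrow> a \<in> I \<Longrightarrow> s * a \<in> I"
  unfolding semiring_ideal_def by blast+

lemma semiring_ideal_dvd: "semiring_ideal I \<Longrightarrow> a \<in> I \<Longrightarrow> a dvd b \<Longrightarrow> b \<in> I"
  by (auto simp: mult.commute elim!: dvdE intro: semiring_ideal_mult)

lemma semiring_ideal_zero:
  assumes "semiring_ideal I"
  shows "0 \<in> I"
proof -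
  obtain a where "a \<in> I"
    using assms unfolding semiring_ideal_def by blast
  then show ?thesis
    using semiring_ideal_dvd[OF assms] by simp
qed

lemma semiring_ideal_multiples: "semiring_ideal {x. a dvd x}"
  unfolding semiring_ideal_def by auto

lemma principal_semiring_ideal_iff: "principal_semiring_ideal I \<longleftrightarrow> (\<exists>a. I = {x. a dvd x})"
proof -
  have "{s * a | s. True} = {x. a dvd x}" for a :: 'a
    by (auto simp: dvd_def mult.commute)
  then show ?thesis
    unfolding principal_semiring_ideal_def by simp
qed

text \<open>Used to adjoin one more element to an ideal that is maximal for avoiding the powers of
  \<open>d\<close>.\<close>

lemma semiring_ideal_sum:
  assumes I: "semiring_ideal I" and J: "semiring_ideal J"
  shows "semiring_ideal {x + y | x y. x \<in> I \<and> y \<in> J}" (is "semiring_ideal ?K")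
  unfolding semiring_ideal_def
proof (intro conjI ballI allI)
  show "?K \<noteq> {}"
    using semiring_ideal_zero[OF I] semiring_ideal_zero[OF J] by blast
next
  fix a b assume "a \<in> ?K" "b \<in> ?K"
  then obtain x y x' y' where "x \<in> I" "y \<in> J" "a = x + y" "x' \<in> I" "y' \<in> J" "b = x' + y'"
    by blast
  then have "a + b = (x + x') + (y + y')" "x + x' \<in> I" "y + y' \<in> J"
    by (auto simp: algebra_simps intro: semiring_ideal_add I J)
  then show "a + b \<in> ?K"
    by blast
next
  fix s a assume "a \<in> ?K"
  then obtain x y where "x \<in> I" "y \<in> J" "a = x + y"
    by blast
  then have "s * a = s * x + s * y" "s * x \<in> I" "s * y \<in> J"
    by (auto simp: algebra_simps intro: semiring_ideal_mult I J)
  then show "s * a \<in> ?K"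
    by blast
qed

text \<open>Two elements of the union lie in a common member of the chain, the larger of the two.
  This supplies the upper bounds for Zorn's lemma.\<close>

lemma semiring_ideal_Union_chain:
  assumes "subset.chain {I. semiring_ideal I} C" and "C \<noteq> {}"
  shows "semiring_ideal (\<Union>C)"
  unfolding semiring_ideal_def
proof (intro conjI ballI allI)
  have ideal: "semiring_ideal I" if "I \<in> C" for I
    using that assms(1) unfolding subset_chain_def by blast
  show "\<Union>C \<noteq> {}"
    using assms(2) semiring_ideal_zero[OF ideal] by blast
  show "s * a \<in> \<Union>C" if "a \<in> \<Union>C" for s a
    using that semiring_ideal_mult[OF ideal] by blast
  fix a b assume "a \<in> \<Union>C" "b \<in> \<Union>C"
  then obtain I J where IJ: "I \<in> C" "J \<in> C" "a \<in> I" "b \<in> J"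
    by blast
  moreover have "I \<subseteq> J \<or> J \<subseteq> I"
    using assms(1) IJ unfolding subset_chain_def by blast
  ultimately show "a + b \<in> \<Union>C"
    using semiring_ideal_add[OF ideal] by blast
qed

section \<open>Prime ideals and Krull's maximality argument\<close>

lemma prime_semiring_ideal_ideal: "prime_semiring_ideal P \<Longrightarrow> semiring_ideal P"
  and prime_semiring_ideal_mult:
    "prime_semiring_ideal P \<Longrightarrow> a * b \<in> P \<Longrightarrow> a \<in> P \<or> b \<in> P"
  unfolding prime_semiring_ideal_def by blast+

lemma prime_semiring_ideal_one: "prime_semiring_ideal P \<Longrightarrow> 1 \<notin> P"
  using semiring_ideal_dvd[of P 1] unfolding prime_semiring_ideal_def by auto

lemma prime_semiring_ideal_power:
  "prime_semiring_ideal P \<Longrightarrow> a ^ n \<in> P \<Longrightarrow> a \<in> P"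
  by (induction n) (auto simp: prime_semiring_ideal_one dest: prime_semiring_ideal_mult)

lemma prime_semiring_ideal_prod:
  assumes "prime_semiring_ideal P" and "finite A" and "prod f A \<in> P"
  shows "\<exists>x\<in>A. f x \<in> P"
  using assms(2,3)
  by (induction A)
    (auto simp: prime_semiring_ideal_one[OF assms(1)]
      dest: prime_semiring_ideal_mult[OF assms(1)])

text \<open>Among the ideals containing \<open>b\<close> but no power of \<open>d\<close>, the
  multiples of \<open>b\<close> being one, Zorn's lemma gives a maximal one. It is prime because
  powers of \<open>d\<close> are closed under multiplication.\<close>

lemma exists_prime_semiring_ideal_avoiding_powers:
  assumes "\<And>n. \<not> b dvd d ^ n"
  shows "\<exists>P. prime_semiring_ideal P \<and> b \<in> P \<and> d \<notin> P"
proof -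
  define A where "A = {I. semiring_ideal I \<and> b \<in> I \<and> (\<forall>n. d ^ n \<notin> I)}"
  have "{x. b dvd x} \<in> A"
    using assms semiring_ideal_multiples by (auto simp: A_def)
  moreover have "\<Union>C \<in> A" if "C \<noteq> {}" "subset.chain A C" for C
  proof -
    have "C \<subseteq> A" "subset.chain {I. semiring_ideal I} C"
      using that(2) by (auto simp: A_def subset_chain_def)
    with that(1) show ?thesis
      using semiring_ideal_Union_chain[of C] by (fastforce simp: A_def)
  qed
  ultimately obtain P where P: "P \<in> A" and max: "\<And>I. I \<in> A \<Longrightarrow> P \<subseteq> I \<Longrightarrow> I = P"
    using subset_Zorn_nonempty[of A] by blast
  have ideal: "semiring_ideal P" and b: "b \<in> P" and avoid: "\<And>n. d ^ n \<notin> P"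
    using P by (auto simp: A_def)
  \<comment> \<open>The ideal P + (a) is strictly larger than \<open>P\<close> and contains
    \<open>b\<close>, so by maximality it must contain a power of \<open>d\<close>.\<close>
  have meet: "\<exists>n x s. x \<in> P \<and> d ^ n = x + s * a" if "a \<notin> P" for a
  proof -
    define K where "K = {x + y | x y. x \<in> P \<and> y \<in> {z. a dvd z}}"
    have K: "semiring_ideal K"
      unfolding K_def using ideal semiring_ideal_multiples by (rule semiring_ideal_sum)
    have K_iff: "z \<in> K \<longleftrightarrow> (\<exists>x s. x \<in> P \<and> z = x + s * a)" for z
      unfolding K_def by (auto simp: dvd_def mult.commute)
    have "P \<subseteq> K"
    proof
      fix x assume "x \<in> P"
      then show "x \<in> K"
        unfolding K_iff by (intro exI[of _ x] exI[of _ 0]) simp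
    qed
    moreover have "a \<in> K"
      unfolding K_iff
      using semiring_ideal_zero[OF ideal] by (intro exI[of _ 0] exI[of _ 1]) simp
    ultimately have "K \<notin> A"
      using max[of K] that by blast
    then obtain n where "d ^ n \<in> K"
      using K b \<open>P \<subseteq> K\<close> unfolding A_def by blast
    then show ?thesis
      unfolding K_iff by blast
  qed
  have "a \<in> P \<or> c \<in> P" if ac: "a * c \<in> P" for a c
  proof (rule ccontr)
    assume "\<not> (a \<in> P \<or> c \<in> P)"
    then obtain m x s n y t where
      x: "x \<in> P" "d ^ m = x + s * a" and y: "y \<in> P" "d ^ n = y + t * c"
      using meet by metis
    \<comment> \<open>Expanding the product of the two powers without subtraction leaves terms that
      are multiples of \<open>x\<close>, \<open>y\<close> or \<open>a * c\<close>, all in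
      \<open>P\<close>.\<close>
    have "d ^ (m + n) = (y + t * c) * x + ((s * a) * y + (s * t) * (a * c))"
      by (simp add: power_add x(2) y(2) algebra_simps)
    also have "\<dots> \<in> P"
    proof (rule semiring_ideal_add[OF ideal])
      show "(y + t * c) * x \<in> P"
        using x(1) by (rule semiring_ideal_mult[OF ideal])
      show "s * a * y + s * t * (a * c) \<in> P"
        using semiring_ideal_mult[OF ideal y(1), of "s * a"]
          semiring_ideal_mult[OF ideal ac, of "s * t"] by (rule semiring_ideal_add[OF ideal])
    qed
    finally show False
      using avoid by blast
  qed
  then have "prime_semiring_ideal P"
    using ideal avoid unfolding prime_semiring_ideal_def by blast
  then show ?thesis
    using b avoid[of 1] by auto
qed

section \<open>Prime ideals of principal ideal semidomains\<close>

text \<open>Distinct nonzero principal primes are incomparable: if q = ps with (q) prime, then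
  \<open>q\<close> divides \<open>p\<close> or \<open>s\<close>, and in the second case cancelling
  \<open>q\<close> would make \<open>p\<close> a unit.\<close>

lemma prime_principal_ideals_eq:
  fixes p q :: "'a::semidomain"
  assumes "prime_semiring_ideal {x. p dvd x}" and "prime_semiring_ideal {x. q dvd x}"
    and "q \<noteq> 0" and "p dvd q"
  shows "{x. p dvd x} = {x. q dvd x}"
proof -
  obtain s where s: "q = p * s"
    using \<open>p dvd q\<close> ..
  have "\<not> q dvd s"
  proof
    assume "q dvd s"
    then obtain t where "s = q * t" ..
    then have "q * (p * t) = q * 1"
      using s by (simp add: ac_simps)
    then have "p dvd 1"
      using \<open>q \<noteq> 0\<close> by (metis semidomain_cancel dvd_triv_left)
    then show False
      using prime_semiring_ideal_one[OF assms(1)] by simp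
  qed
  then have "q dvd p"
    using prime_semiring_ideal_mult[OF assms(2), of p s] s by auto
  with \<open>p dvd q\<close> show ?thesis
    by (auto intro: dvd_trans)
qed

text \<open>Incomparability replaces coprimality: a further prime \<open>P\<close> contains
  \<open>d\<close> but not the product taken so far, hence contains the cofactor.\<close>

lemma prod_distinct_primes_dvd:
  fixes g :: "'a set \<Rightarrow> 'a::semidomain"
  assumes "finite F" and "\<And>P. P \<in> F \<Longrightarrow> prime_semiring_ideal P"
    and "\<And>P x. P \<in> F \<Longrightarrow> x \<in> P \<longleftrightarrow> g P dvd x" and "\<And>P. P \<in> F \<Longrightarrow> g P \<noteq> 0"
    and "\<And>P. P \<in> F \<Longrightarrow> d \<in> P"
  shows "prod g F dvd d"
  using assms
proof (induction F)
  case empty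
  then show ?case by simp
next
  case (insert P F)
  have gen: "x \<in> Q \<longleftrightarrow> g Q dvd x" and prime: "prime_semiring_ideal Q"
    and nz: "g Q \<noteq> 0" and mem: "d \<in> Q" if "Q \<in> insert P F" for Q x
    using that insert.prems by simp_all
  have gen_eq: "{x. g Q dvd x} = Q" if "Q \<in> insert P F" for Q
    using gen[OF that] by blast
  have "prod g F dvd d"
    by (intro insert.IH) (use prime gen nz mem in blast)+
  then obtain e where e: "d = prod g F * e" ..
  have "prod g F \<notin> P"
  proof
    assume "prod g F \<in> P"
    then obtain Q where Q: "Q \<in> F" "g Q \<in> P"
      using prime_semiring_ideal_prod[OF prime[of P] insert.hyps(1)] by blast
    \<comment> \<open>From \<open>g Q \<in> P\<close> follows \<open>g P dvd g Q\<close>, so the two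
      primes are comparable and therefore equal.\<close>
    then have "{x. g P dvd x} = {x. g Q dvd x}"
      by (intro prime_principal_ideals_eq) (simp_all add: gen_eq prime nz flip: gen)
    then show False
      using Q(1) insert.hyps(2) by (simp add: gen_eq)
  qed
  then have "e \<in> P"
    using prime_semiring_ideal_mult[OF prime[of P], of "prod g F" e] mem[of P] e by simp
  then have "g P dvd e"
    by (simp add: gen)
  then show ?case
    using e insert.hyps by (simp add: mult.commute[of "g P"] mult_dvd_mono)
qed

text \<open>An ascending chain argument in a single ideal: its generator is already reached by a
  finite product of prime generators, so a further prime generator dividing \<open>d\<close> would
  have to be a unit.\<close>

lemma finite_primes_containing:
  fixes d :: "'a::semidomain"
  assumes pid: "principal_ideal_semidomain TYPE('a)" and "d \<noteq> 0"
  shows "finite {P. prime_semiring_ideal P \<and> d \<in> P}" (is "finite ?Q")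
proof (rule ccontr)
  assume inf: "infinite ?Q"
  have pid': "\<exists>a. I = {x. a dvd x}" if "semiring_ideal I" for I :: "'a set"
    using pid that unfolding principal_ideal_semidomain_def principal_semiring_ideal_iff by blast
  then have "\<forall>P\<in>?Q. \<exists>a. P = {x. a dvd x}"
    using prime_semiring_ideal_ideal by blast
  then have "\<exists>g. \<forall>P\<in>?Q. P = {x. g P dvd x}"
    by (rule bchoice)
  then obtain g where "\<forall>P\<in>?Q. P = {x. g P dvd x}" ..
  then have gen: "x \<in> P \<longleftrightarrow> g P dvd x" if "P \<in> ?Q" for P x
    using that by blast
  have nz: "g P \<noteq> 0" if "P \<in> ?Q" for P
  proof
    assume "g P = 0"
    then show False
      using gen[OF that, of d] that \<open>d \<noteq> 0\<close> by simp
  qed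
  \<comment> \<open>the union of the ascending chain of ideals generated by \<open>d\<close> divided by longer and longer
    products of distinct primes\<close>
  define J where "J = {x. \<exists>F. finite F \<and> F \<subseteq> ?Q \<and> d dvd x * prod g F}"
  have "d \<in> J"
    unfolding J_def by (auto intro!: exI[of _ "{}"])
  have "semiring_ideal J"
    unfolding semiring_ideal_def
  proof (intro conjI ballI allI)
    show "J \<noteq> {}"
      using \<open>d \<in> J\<close> by blast
    show "s * a \<in> J" if "a \<in> J" for s a
      using that unfolding J_def by (auto simp: mult.assoc)
    fix a b assume "a \<in> J" "b \<in> J"
    then obtain F F' where F: "finite F" "F \<subseteq> ?Q" "d dvd a * prod g F"
      and F': "finite F'" "F' \<subseteq> ?Q" "d dvd b * prod g F'"
      unfolding J_def by blast
    have sub: "prod g F dvd prod g (F \<union> F')" "prod g F' dvd prod g (F \<union> F')"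
      using F(1) F'(1) by (auto intro!: prod_dvd_prod_subset)
    have "d dvd a * prod g (F \<union> F')" "d dvd b * prod g (F \<union> F')"
      using dvd_trans[OF F(3) mult_dvd_mono[OF dvd_refl sub(1)]]
        dvd_trans[OF F'(3) mult_dvd_mono[OF dvd_refl sub(2)]] .
    then have "d dvd (a + b) * prod g (F \<union> F')"
      by (simp add: distrib_right)
    moreover have "finite (F \<union> F')" "F \<union> F' \<subseteq> ?Q"
      using F F' by auto
    ultimately show "a + b \<in> J"
      unfolding J_def by blast
  qed
  then obtain c where c: "J = {x. c dvd x}"
    using pid' by blast
  then have "c \<in> J"
    by simp
  \<comment> \<open>Since \<open>c\<close> generates \<open>J\<close>, this one finite set
    \<open>F\<close> works for every element of \<open>J\<close>.\<close>
  then obtain F where F: "finite F" "F \<subseteq> ?Q" "d dvd c * prod g F"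
    unfolding J_def by blast
  obtain P where P: "P \<in> ?Q" "P \<notin> F"
    using F(1,2) inf by (meson finite_subset subsetI)
  have "prod g (insert P F) dvd d"
  proof (rule prod_distinct_primes_dvd)
    show "finite (insert P F)"
      using F(1) by simp
    have "insert P F \<subseteq> ?Q"
      using F(2) P(1) by blast
    then show "prime_semiring_ideal R" "x \<in> R \<longleftrightarrow> g R dvd x" "g R \<noteq> 0" "d \<in> R"
      if "R \<in> insert P F" for R x
      using that gen nz by blast+
  qed
  \<comment> \<open>The quotient \<open>e\<close> of \<open>d\<close> by the longer product lies in
    \<open>J\<close> with witness \<open>insert P F\<close>, so it is a multiple of
    \<open>c\<close>.\<close>
  then obtain e where e: "d = prod g (insert P F) * e" ..
  then have "d dvd e * prod g (insert P F)"
    by (simp add: mult.commute)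
  then have "e \<in> J"
    using F(1,2) P(1) unfolding J_def by blast
  then obtain t where t: "e = c * t"
    using c by (auto elim: dvdE)
  obtain u where u: "c * prod g F = d * u"
    using F(3) ..
  \<comment> \<open>The right side is the longer product times \<open>e\<close>, that is
    \<open>d\<close>; cancelling \<open>d\<close> turns \<open>g P\<close> into a unit.\<close>
  have "d * (g P * (t * u)) = g P * t * (c * prod g F)"
    by (simp only: u ac_simps)
  also have "\<dots> = d * 1"
    using e t F(1) P(2) by (simp add: ac_simps)
  finally have "g P * (t * u) = 1"
    using semidomain_cancel \<open>d \<noteq> 0\<close> by blast
  then have "g P dvd 1"
    by (metis dvd_triv_left)
  then have "1 \<in> P"
    using gen[OF P(1)] by blast
  then show False
    using P(1) prime_semiring_ideal_one by blast
qed

section \<open>Goldman-Krull semidomains\<close>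

lemma semifraction_embed_zero [simp]: "semifraction_embed 0 = 0"
  and semifraction_embed_one [simp]: "semifraction_embed 1 = 1"
  and semifraction_embed_add: "semifraction_embed (a + b) = semifraction_embed a + semifraction_embed b"
  and semifraction_embed_mult: "semifraction_embed (a * b) = semifraction_embed a * semifraction_embed b"
  by (simp_all add: semifraction_embed_def zero_eq_Frac one_eq_Frac Frac_add Frac_mult)

lemma semifraction_embed_power: "semifraction_embed (a ^ n) = semifraction_embed a ^ n"
  by (induction n) (simp_all add: semifraction_embed_mult)

lemma Frac_mult_embed:
  assumes "b \<noteq> 0" and "b dvd c"
  shows "Frac a b * semifraction_embed c \<in> range semifraction_embed"
proof -
  obtain k where "c = b * k"
    using \<open>b dvd c\<close> ..
  then have "Frac a b * semifraction_embed c = semifraction_embed (a * k)"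
    using \<open>b \<noteq> 0\<close> by (simp add: semifraction_embed_def Frac_mult Frac_eq_iff ac_simps)
  then show ?thesis
    by blast
qed

text \<open>For nonzero \<open>d\<close> this is membership in the localization S[1/d]. Clearing the
  denominator by multiplication avoids choosing a representative of \<open>x\<close>.\<close>

definition denominator_power :: "'a::semidomain \<Rightarrow> 'a semifraction \<Rightarrow> bool" where
  "denominator_power d x \<longleftrightarrow> (\<exists>n. x * semifraction_embed (d ^ n) \<in> range semifraction_embed)"

section \<open>Closure properties of the localization at the powers of an element\<close>

lemma denominator_power_embed: "denominator_power d (semifraction_embed a)"
  unfolding denominator_power_def by (intro exI[of _ 0]) simp

lemma denominator_power_add:
  assumes "denominator_power d x" and "denominator_power d y"
  shows "denominator_power d (x + y)"
proof -
  obtain m a n b where x: "x * semifraction_embed (d ^ m) = semifraction_embed a"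
    and y: "y * semifraction_embed (d ^ n) = semifraction_embed b"
    using assms unfolding denominator_power_def by blast
  have "(x + y) * semifraction_embed (d ^ (m + n))
      = (x * semifraction_embed (d ^ m)) * semifraction_embed (d ^ n)
        + (y * semifraction_embed (d ^ n)) * semifraction_embed (d ^ m)"
    by (simp add: power_add semifraction_embed_mult algebra_simps)
  also have "\<dots> = semifraction_embed (a * d ^ n + b * d ^ m)"
    by (simp only: x y semifraction_embed_mult semifraction_embed_add)
  finally show ?thesis
    unfolding denominator_power_def by blast
qed

lemma denominator_power_mult:
  assumes "denominator_power d x" and "denominator_power d y"
  shows "denominator_power d (x * y)"
proof -
  obtain m a n b where x: "x * semifraction_embed (d ^ m) = semifraction_embed a"
    and y: "y * semifraction_embed (d ^ n) = semifraction_embed b"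
    using assms unfolding denominator_power_def by blast
  have "(x * y) * semifraction_embed (d ^ (m + n))
      = (x * semifraction_embed (d ^ m)) * (y * semifraction_embed (d ^ n))"
    by (simp add: power_add semifraction_embed_mult ac_simps)
  also have "\<dots> = semifraction_embed (a * b)"
    by (simp only: x y semifraction_embed_mult)
  finally show ?thesis
    unfolding denominator_power_def by blast
qed

lemma denominator_power_sum:
  "(\<And>i. i < (m::nat) \<Longrightarrow> denominator_power d (f i)) \<Longrightarrow> denominator_power d (\<Sum>i<m. f i)"
proof (induction m)
  case 0
  show ?case
    using denominator_power_embed[of d 0] by simp
next
  case (Suc m)
  then show ?case
    by (simp add: denominator_power_add)
qed

lemma denominator_power_submonoid:
  assumes "x \<in> generated_submonoid G" and "\<And>t. t \<in> G \<Longrightarrow> denominator_power d t"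
  shows "denominator_power d x"
  using assms(1)
proof induction
  case one
  show ?case
    using denominator_power_embed[of d 1] by simp
qed (simp_all add: assms(2) denominator_power_mult)

lemma power_in_generated_submonoid: "t \<in> G \<Longrightarrow> t ^ n \<in> generated_submonoid G"
  by (induction n) (auto intro: generated_submonoid.intros)

text \<open>The product of chosen denominators of the elements of \<open>G\<close> works, already
  with exponent 1.\<close>

lemma exists_common_denominator:
  fixes G :: "'a::semidomain semifraction set"
  assumes "finite G"
  shows "\<exists>d. d \<noteq> 0 \<and> (\<forall>t\<in>G. denominator_power d t)"
proof -
  \<comment> \<open>Choosing denominators for all fractions at once keeps
    \<open>b t \<noteq> 0\<close> free of side conditions in the induction on
    \<open>G\<close>.\<close>
  have "\<forall>t :: 'a semifraction. \<exists>b a. b \<noteq> 0 \<and> t = Frac a b"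
    using semifraction_cases by metis
  then obtain b :: "'a semifraction \<Rightarrow> 'a" where b: "\<And>t. b t \<noteq> 0 \<and> (\<exists>a. t = Frac a (b t))"
    by metis
  have "denominator_power (prod b G) t" if t: "t \<in> G" for t
  proof -
    obtain a where a: "t = Frac a (b t)"
      using b by blast
    have "b t dvd prod b G"
      using assms t by (rule dvd_prodI)
    then have "Frac a (b t) * semifraction_embed (prod b G ^ 1) \<in> range semifraction_embed"
      using b by (simp add: Frac_mult_embed)
    then show ?thesis
      using a unfolding denominator_power_def by metis
  qed
  moreover have "prod b G \<noteq> 0"
    using assms by (induction G) (simp_all add: b)
  ultimately show ?thesis
    by blast
qed

text \<open>Both sides say that F(S) = S[1/d] for some nonzero \<open>d\<close>: a common
  denominator of finitely many generators serves all of F(S), and conversely 1/d alone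
  generates.\<close>

lemma Goldman_Krull_iff:
  "Goldman_Krull TYPE('a::semidomain) \<longleftrightarrow>
    (\<exists>d::'a. d \<noteq> 0 \<and> (\<forall>b. b \<noteq> 0 \<longrightarrow> (\<exists>n. b dvd d ^ n)))"
proof
  let ?S = "range (semifraction_embed :: 'a \<Rightarrow> 'a semifraction)"
  assume "Goldman_Krull TYPE('a)"
  then obtain G :: "'a semifraction set" where "finite G" and
    G: "\<And>x. \<exists>(m::nat) s y. (\<forall>i<m. s i \<in> ?S \<and> y i \<in> generated_submonoid G) \<and>
      x = (\<Sum>i<m. s i * y i)"
    unfolding Goldman_Krull_def finitely_generated_semiring_over_def by blast
  obtain d :: 'a where "d \<noteq> 0" and d: "\<And>t. t \<in> G \<Longrightarrow> denominator_power d t"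
    using exists_common_denominator[OF \<open>finite G\<close>] by blast
  have all: "denominator_power d x" for x
  proof -
    obtain m :: nat and s y where sy: "\<forall>i<m. s i \<in> ?S \<and> y i \<in> generated_submonoid G"
      and x: "x = (\<Sum>i<m. s i * y i)"
      using G[of x] by blast
    have "denominator_power d (s i * y i)" if "i < m" for i
    proof (rule denominator_power_mult)
      show "denominator_power d (s i)"
        using sy that denominator_power_embed by (metis imageE)
      show "denominator_power d (y i)"
        using sy that d denominator_power_submonoid by blast
    qed
    then show ?thesis
      unfolding x by (rule denominator_power_sum)
  qed
  have "\<exists>n. b dvd d ^ n" if "b \<noteq> 0" for b
  proof -
    \<comment> \<open>Applied to 1/b, clearing denominators by a power of \<open>d\<close> is
      exactly divisibility of that power by \<open>b\<close>.\<close>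
    obtain n a where "Frac 1 b * semifraction_embed (d ^ n) = semifraction_embed a"
      using all[of "Frac 1 b"] unfolding denominator_power_def by blast
    then have "d ^ n = b * a"
      using that by (simp add: semifraction_embed_def Frac_mult Frac_eq_iff)
    then show ?thesis
      by (metis dvd_triv_left)
  qed
  with \<open>d \<noteq> 0\<close> show "\<exists>d::'a. d \<noteq> 0 \<and> (\<forall>b. b \<noteq> 0 \<longrightarrow> (\<exists>n. b dvd d ^ n))"
    by blast
next
  let ?S = "range (semifraction_embed :: 'a \<Rightarrow> 'a semifraction)"
  assume "\<exists>d::'a. d \<noteq> 0 \<and> (\<forall>b. b \<noteq> 0 \<longrightarrow> (\<exists>n. b dvd d ^ n))"
  then obtain d :: 'a where "d \<noteq> 0" and d: "\<And>b. b \<noteq> 0 \<Longrightarrow> \<exists>n. b dvd d ^ n"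
    by blast
  have "\<exists>(m::nat) s y. (\<forall>i<m. s i \<in> ?S \<and> y i \<in> generated_submonoid {Frac 1 d}) \<and>
      x = (\<Sum>i<m. s i * y i)" for x
  proof -
    obtain a b where b: "b \<noteq> 0" and x: "x = Frac a b"
      by (rule semifraction_cases)
    obtain n where n: "b dvd d ^ n"
      using d[OF b] by blast
    obtain c where c: "x * semifraction_embed (d ^ n) = semifraction_embed c"
      using Frac_mult_embed[OF b n, of a] x by blast
    have "semifraction_embed d * Frac 1 d = 1"
      using \<open>d \<noteq> 0\<close> by (simp add: semifraction_embed_def one_eq_Frac Frac_mult Frac_eq_iff)
    then have "semifraction_embed (d ^ n) * Frac 1 d ^ n = 1"
      by (simp add: semifraction_embed_power flip: power_mult_distrib)
    then have "x = semifraction_embed c * Frac 1 d ^ n"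
      by (simp add: mult.assoc flip: c)
    then show ?thesis
      \<comment> \<open>A single summand suffices, because x = c/d^n.\<close>
      by (intro exI[of _ "1::nat"] exI[of _ "\<lambda>_. semifraction_embed c"]
          exI[of _ "\<lambda>_. Frac 1 d ^ n"]) (simp add: power_in_generated_submonoid)
  qed
  then show "Goldman_Krull TYPE('a)"
    unfolding Goldman_Krull_def finitely_generated_semiring_over_def
    using subsemiring_range_embed by (intro conjI exI[of _ "{Frac 1 d}"]) auto
qed

theorem theorem6p7:
  assumes "principal_ideal_semidomain TYPE('a::semidomain)"
  shows "Goldman_Krull TYPE('a) \<longleftrightarrow> finite {P :: 'a set. prime_semiring_ideal P}"
proof
  assume "Goldman_Krull TYPE('a)"
  then obtain d :: 'a where "d \<noteq> 0" and d: "\<And>b. b \<noteq> 0 \<Longrightarrow> \<exists>n. b dvd d ^ n"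
    unfolding Goldman_Krull_iff by blast
  \<comment> \<open>A nonzero element of \<open>P\<close> divides a power of \<open>d\<close>, so
    that power, and by primality \<open>d\<close> itself, lies in \<open>P\<close>.\<close>
  have "P = {0} \<or> d \<in> P" if P: "prime_semiring_ideal P" for P
  proof (rule ccontr)
    assume "\<not> (P = {0} \<or> d \<in> P)"
    then obtain b where "b \<in> P" "b \<noteq> 0" "d \<notin> P"
      using semiring_ideal_zero[OF prime_semiring_ideal_ideal[OF P]] by blast
    then show False
      using d semiring_ideal_dvd[OF prime_semiring_ideal_ideal[OF P]]
        prime_semiring_ideal_power[OF P] by blast
  qed
  then have "{P. prime_semiring_ideal P} \<subseteq> insert {0} {P. prime_semiring_ideal P \<and> d \<in> P}"
    by blast
  then show "finite {P :: 'a set. prime_semiring_ideal P}"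
    using finite_primes_containing[OF assms \<open>d \<noteq> 0\<close>] by (rule finite_subset[OF _ finite.insertI])
next
  assume fin: "finite {P :: 'a set. prime_semiring_ideal P}"
  \<comment> \<open>The zero ideal is left out because no nonzero element can be picked from it. If
    \<open>Q\<close> is empty, the product below is 1.\<close>
  define Q where "Q = {P :: 'a set. prime_semiring_ideal P \<and> P \<noteq> {0}}"
  have "finite Q"
    using fin by (rule rev_finite_subset) (auto simp: Q_def)
  have "\<forall>P\<in>Q. \<exists>a\<in>P. a \<noteq> 0"
    using semiring_ideal_zero[OF prime_semiring_ideal_ideal] by (auto simp: Q_def)
  then obtain f where f: "\<And>P. P \<in> Q \<Longrightarrow> f P \<in> P \<and> f P \<noteq> 0"
    by metis
  have "prod f Q \<noteq> 0"
    using \<open>finite Q\<close> f by (induction Q) simp_all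
  moreover have "\<exists>n. b dvd prod f Q ^ n" if "b \<noteq> 0" for b
  proof (rule ccontr)
    assume "\<nexists>n. b dvd prod f Q ^ n"
    then obtain P where P: "prime_semiring_ideal P" "b \<in> P" "prod f Q \<notin> P"
      using exists_prime_semiring_ideal_avoiding_powers by blast
    \<comment> \<open>The nonzero \<open>b\<close> in \<open>P\<close> rules out the zero ideal, so
      the factor \<open>f P\<close> forces the whole product into \<open>P\<close>.\<close>
    then have "P \<in> Q"
      using that by (auto simp: Q_def)
    then have "f P dvd prod f Q"
      by (rule dvd_prodI[OF \<open>finite Q\<close>])
    then show False
      using P(3) f[OF \<open>P \<in> Q\<close>] semiring_ideal_dvd[OF prime_semiring_ideal_ideal[OF P(1)]] by blast
  qed
  ultimately show "Goldman_Krull TYPE('a)"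
    unfolding Goldman_Krull_iff by blast
qed

end
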